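(* There is no deterministic online algorithm for the discrete setting of the restricted data-center model that achieves a competitive ratio $c<3$.
   Context: Restricted model: given $m\in\mathbb{N}$, $\beta>0$, a non-negative convex function $f:[0,1]\to\mathbb{R}_{\ge0}$ (known in advance) and loads $\lambda_1,\dots,\lambda_T\ge0$, find $X=(x_1,\dots,x_T)$ with $x_t\in\{0,\dots,m\}$ (discrete setting) and $x_t\ge\lambda_t$ minimizing $\sum_{t=1}^T x_tf(\lambda_t/x_t)+\beta\sum_{t=1}^T(x_t-x_{t-1})^+$ with $x_0=0$ and $(y)^+=\max(0,y)$. Online: $\lambda_t$ is revealed at time $t$ and $x_t$ must be chosen then, irrevocably. An online algorithm has competitive ratio $c$ if on every instance its cost is at most $c$ times the optimal offline cost. *)

theory Defs
  imports "HOL-Analysis.Analysis"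
begin

text \<open>
  An instance consists of \<open>m\<close>, \<open>\<beta>\<close>, \<open>f\<close>, the horizon \<open>T\<close> and loads \<open>l 1, \<dots>, l T\<close>. Only the values
  of \<open>f\<close> on \<open>{0..1}\<close> and of \<open>l\<close> on \<open>{1..T}\<close> matter. The bound \<open>l t \<le> m\<close> says exactly
  that the instance admits a feasible schedule; otherwise no algorithm could serve it and
  competitiveness would fail for a trivial reason.
\<close>

definition dc_instance :: "nat \<Rightarrow> real \<Rightarrow> (real \<Rightarrow> real) \<Rightarrow> nat \<Rightarrow> (nat \<Rightarrow> real) \<Rightarrow> bool" where
  "dc_instance m \<beta> f T l \<longleftrightarrow>
     \<beta> > 0 \<and> convex_on {0..1} f \<and> (\<forall>z\<in>{0..1}. f z \<ge> 0) \<and>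
     (\<forall>t\<in>{1..T}. 0 \<le> l t \<and> l t \<le> real m)"

definition feasible :: "nat \<Rightarrow> nat \<Rightarrow> (nat \<Rightarrow> real) \<Rightarrow> (nat \<Rightarrow> nat) \<Rightarrow> bool" where
  "feasible m T l x \<longleftrightarrow> x 0 = 0 \<and> (\<forall>t\<in>{1..T}. x t \<le> m \<and> l t \<le> real (x t))"

text \<open>
  If \<open>x t = 0\<close> (which feasibility permits only for \<open>l t = 0\<close>), the operating cost is \<open>0\<close>.
\<close>

definition cost :: "real \<Rightarrow> (real \<Rightarrow> real) \<Rightarrow> nat \<Rightarrow> (nat \<Rightarrow> real) \<Rightarrow> (nat \<Rightarrow> nat) \<Rightarrow> real" where
  "cost \<beta> f T l x =
     (\<Sum>t=1..T. real (x t) * f (l t / real (x t))) +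
     \<beta> * (\<Sum>t=1..T. max 0 (real (x t) - real (x (t - 1))))"

text \<open>
  On instances the infimum is over a non-empty finite set of costs, hence a minimum.
\<close>

definition opt_cost :: "nat \<Rightarrow> real \<Rightarrow> (real \<Rightarrow> real) \<Rightarrow> nat \<Rightarrow> (nat \<Rightarrow> real) \<Rightarrow> real" where
  "opt_cost m \<beta> f T l = Inf {cost \<beta> f T l x | x. feasible m T l x}"

text \<open>
  A deterministic online algorithm knows \<open>m\<close>, \<open>\<beta>\<close> and \<open>f\<close> in advance and maps the loads
  \<open>[l 1, \<dots>, l t]\<close> revealed so far to the state \<open>x t\<close>; it does not know the horizon \<open>T\<close>. Its own
  earlier decisions are functions of the same data, so they need not be arguments.
\<close>

type_synonym online_algorithm = "nat \<Rightarrow> real \<Rightarrow> (real \<Rightarrow> real) \<Rightarrow> real list \<Rightarrow> nat"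

definition online_schedule ::
    "online_algorithm \<Rightarrow> nat \<Rightarrow> real \<Rightarrow> (real \<Rightarrow> real) \<Rightarrow> (nat \<Rightarrow> real) \<Rightarrow> nat \<Rightarrow> nat" where
  "online_schedule A m \<beta> f l t = (if t = 0 then 0 else A m \<beta> f (map l [1..<Suc t]))"

definition competitive :: "online_algorithm \<Rightarrow> real \<Rightarrow> bool" where
  "competitive A c \<longleftrightarrow>
     (\<forall>m \<beta> f T l. dc_instance m \<beta> f T l \<longrightarrow>
        feasible m T l (online_schedule A m \<beta> f l) \<and>
        cost \<beta> f T l (online_schedule A m \<beta> f l) \<le> c * opt_cost m \<beta> f T l)"

end

theory Submission
  imports Defs
begin

text \<open>
  Take \<open>m = 2\<close>, \<open>\<beta> = 2\<close> and \<open>f z = \<epsilon> \<bar>1 - 2 z\<bar>\<close>. Under load \<open>1\<close> only the state \<open>1\<close> has operating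
  cost (namely \<open>\<epsilon>\<close>), under load \<open>1/2\<close> only the state \<open>2\<close> does, and the state \<open>0\<close> is infeasible: this
  is a two-state metrical task system. The adversary always charges the current state of the online
  algorithm. As in the lower bound of Borodin, Linial and Saks, consider three offline schedules, one
  in the state of the online algorithm and two in the other one. Up to the factor \<open>1 + 2 \<epsilon>\<close> and an
  additive constant their total cost is at most the online cost, which tends to infinity.
\<close>

definition vee :: "real \<Rightarrow> real \<Rightarrow> real" where
  "vee \<epsilon> z = \<epsilon> * \<bar>1 - 2 * z\<bar>"

lemma vee_values [simp]:
  "vee \<epsilon> 1 = \<epsilon>" "vee \<epsilon> (1/2) = 0" "2 * vee \<epsilon> (1/4) = \<epsilon>"
  by (auto simp: vee_def)

text \<open>Here \<open>v\<close> is the charged state and \<open>u\<close> the occupied one. The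
  load that charges \<open>v\<close> puts the other state at utilization 1/2, the zero of
  \<open>vee\<close>, while \<open>v\<close> itself runs at 1 or 1/4.\<close>

lemma vee_operating_cost:
  fixes u v :: nat
  assumes "u \<in> {1, 2}" "v \<in> {1, 2}"
  shows "real u * vee \<epsilon> ((if v = 2 then 1/2 else 1) / real u) = (if u = v then \<epsilon> else 0)"
  using assms by auto

lemma convex_on_vee:
  assumes "0 \<le> \<epsilon>" "convex S"
  shows "convex_on S (vee \<epsilon>)"
proof (rule convex_onI)
  fix t x y :: real
  assume t: "0 < t" "t < 1"
  have "1 - 2 * ((1 - t) * x + t * y) = (1 - t) * (1 - 2 * x) + t * (1 - 2 * y)"
    by (simp add: algebra_simps)
  also have "\<bar>\<dots>\<bar> \<le> (1 - t) * \<bar>1 - 2 * x\<bar> + t * \<bar>1 - 2 * y\<bar>"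
    using t abs_triangle_ineq[of "(1 - t) * (1 - 2 * x)" "t * (1 - 2 * y)"]
    by (simp add: abs_mult)
  finally have "\<epsilon> * \<bar>1 - 2 * ((1 - t) * x + t * y)\<bar>
      \<le> \<epsilon> * ((1 - t) * \<bar>1 - 2 * x\<bar> + t * \<bar>1 - 2 * y\<bar>)"
    using assms(1) by (rule mult_left_mono)
  then show "vee \<epsilon> ((1 - t) *\<^sub>R x + t *\<^sub>R y) \<le> (1 - t) * vee \<epsilon> x + t * vee \<epsilon> y"
    by (simp add: vee_def algebra_simps)
qed (fact assms(2))

lemma cost_0 [simp]: "cost \<beta> f 0 l x = 0"
  by (simp add: cost_def)

lemma cost_Suc:
  "cost \<beta> f (Suc T) l x = cost \<beta> f T l x + real (x (Suc T)) * f (l (Suc T) / real (x (Suc T)))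
     + \<beta> * max 0 (real (x (Suc T)) - real (x T))"
  by (simp add: cost_def algebra_simps)

lemma cost_cong:
  assumes "\<And>t. t \<le> T \<Longrightarrow> x t = y t"
  shows "cost \<beta> f T l x = cost \<beta> f T l y"
  using assms by (induction T) (simp_all add: cost_Suc)

lemma feasible_extend:
  assumes "feasible m T l x" "s \<le> m" "l (Suc T) \<le> real s"
  shows "feasible m (Suc T) l (x(Suc T := s))"
  using assms by (auto simp: feasible_def le_Suc_eq)

lemma cost_extend:
  "cost \<beta> f (Suc T) l (x(Suc T := s)) =
     cost \<beta> f T l x + real s * f (l (Suc T) / real s) + \<beta> * max 0 (real s - real (x T))"
  using cost_cong[of T "x(Suc T := s)" x \<beta> f l] by (simp add: cost_Suc)

lemma cost_nonneg:
  assumes "dc_instance m \<beta> f T l" "feasible m T l x"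
  shows "0 \<le> cost \<beta> f T l x"
proof -
  have "0 \<le> real (x t) * f (l t / real (x t))" if "t \<in> {1..T}" for t
  proof (cases "x t = 0")
    case False
    with that assms have "l t / real (x t) \<in> {0..1}"
      by (auto simp: dc_instance_def feasible_def)
    with assms(1) show ?thesis
      by (auto simp: dc_instance_def)
  qed simp
  moreover have "0 \<le> \<beta>"
    using assms(1) by (simp add: dc_instance_def)
  ultimately show ?thesis
    unfolding cost_def by (intro add_nonneg_nonneg sum_nonneg mult_nonneg_nonneg[of \<beta>]) simp_all
qed

lemma opt_cost_le:
  assumes "dc_instance m \<beta> f T l" "feasible m T l x"
  shows "opt_cost m \<beta> f T l \<le> cost \<beta> f T l x"
  unfolding opt_cost_def
  using assms by (intro cInf_lower bdd_belowI[where m = 0]) (auto intro: cost_nonneg)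

lemma opt_cost_nonneg:
  assumes "dc_instance m \<beta> f T l" "feasible m T l x"
  shows "0 \<le> opt_cost m \<beta> f T l"
  unfolding opt_cost_def
  using assms by (intro cInf_greatest) (auto intro: cost_nonneg)

text \<open>The adversary is not circular: the state at time \<open>t\<close> depends only on the
  first \<open>t\<close> loads. Recursion builds the load prefixes \<open>L n\<close>, and each load
  is the last entry of its prefix.\<close>

lemma adaptive_loads_exist:
  fixes g :: "nat \<Rightarrow> real"
  obtains l where "\<And>t. l (Suc t) = g (online_schedule A m \<beta> f l t)"
proof -
  define L where "L = rec_nat [] (\<lambda>n L. L @ [g (if n = 0 then 0 else A m \<beta> f L)])"
  have L: "L 0 = []" "L (Suc n) = L n @ [g (if n = 0 then 0 else A m \<beta> f (L n))]" for n
    by (simp_all add: L_def)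
  have "map (\<lambda>t. last (L t)) [1..<Suc n] = L n" for n
    by (induction n) (simp_all add: L)
  then have "last (L (Suc t)) = g (online_schedule A m \<beta> f (\<lambda>t. last (L t)) t)" for t
    by (simp add: L online_schedule_def del: upt_Suc)
  then show ?thesis
    by (rule that)
qed

text \<open>
  The schedule \<open>q\<close> counts twice. When the online algorithm leaves the state \<open>u\<close>, the new \<open>p\<close> extends
  \<open>q\<close>, and the new \<open>q\<close> is the cheaper one of \<open>p\<close> staying in \<open>u\<close> and \<open>q\<close> moving to \<open>u\<close>. Since powering
  down is free, a potential on the online state \<open>1\<close> spreads the switching cost evenly.
\<close>

lemma offline_schedules:
  assumes eps: "0 < \<epsilon>" "\<epsilon> \<le> 1"
    and s: "s 0 = 0" "\<And>t. s (Suc t) \<in> {1, 2}"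
    and l: "\<And>t. l (Suc t) = (if s t = 2 then 1/2 else 1)"
  shows "\<exists>p q. feasible 2 (Suc T) l p \<and> feasible 2 (Suc T) l q
     \<and> p (Suc T) = s (Suc T) \<and> q (Suc T) = 3 - s (Suc T)
     \<and> cost 2 (vee \<epsilon>) (Suc T) l p + 2 * cost 2 (vee \<epsilon>) (Suc T) l q
         \<le> (1 + 2 * \<epsilon>) * cost 2 (vee \<epsilon>) (Suc T) l s + (if s (Suc T) = 1 then 2 + 2 * \<epsilon> else 0) + 15"
proof (induction T)
  case 0
  have "feasible 2 0 l (\<lambda>_. 0)" and "l (Suc 0) = 1"
    using s(1) l[of 0] by (simp_all add: feasible_def)
  moreover define x where "x u = ((\<lambda>_. 0)(Suc 0 := u))" for u :: nat
  \<comment> \<open>Powering up costs at most 4 and operation at most \<epsilon> \<le> 1. Three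
    schedules of cost at most 5 account for the constant 15.\<close>
  ultimately have feas: "feasible 2 (Suc 0) l (x u)"
    and le: "cost 2 (vee \<epsilon>) (Suc 0) l (x u) \<le> 5" if "u \<in> {1, 2}" for u
    using that eps feasible_extend[of 2 0 l "\<lambda>_. 0" u] by (auto simp: cost_extend)
  have other: "3 - s (Suc 0) \<in> {1, 2}"
    using s(2)[of 0] by auto
  have "0 \<le> cost 2 (vee \<epsilon>) (Suc 0) l s"
    using s(2)[of 0] s(1) l[of 0] eps by (auto simp: cost_Suc)
  then have "0 \<le> (1 + 2 * \<epsilon>) * cost 2 (vee \<epsilon>) (Suc 0) l s"
    using eps by simp
  moreover have "0 \<le> (if s (Suc 0) = 1 then 2 + 2 * \<epsilon> else 0)"
    using eps by simp
  ultimately have "cost 2 (vee \<epsilon>) (Suc 0) l (x (s (Suc 0)))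
        + 2 * cost 2 (vee \<epsilon>) (Suc 0) l (x (3 - s (Suc 0)))
      \<le> (1 + 2 * \<epsilon>) * cost 2 (vee \<epsilon>) (Suc 0) l s + (if s (Suc 0) = 1 then 2 + 2 * \<epsilon> else 0) + 15"
    using le[OF s(2)[of 0]] le[OF other] by linarith
  moreover have "x u (Suc 0) = u" for u
    by (simp add: x_def)
  ultimately show ?case
    using feas[OF s(2)[of 0]] feas[OF other] by blast
next
  case (Suc T)
  define C where "C = cost 2 (vee \<epsilon>)"
  obtain p q where pq: "feasible 2 (Suc T) l p" "feasible 2 (Suc T) l q"
      "p (Suc T) = s (Suc T)" "q (Suc T) = 3 - s (Suc T)"
    and le: "C (Suc T) l p + 2 * C (Suc T) l q
         \<le> (1 + 2 * \<epsilon>) * C (Suc T) l s + (if s (Suc T) = 1 then 2 + 2 * \<epsilon> else 0) + 15"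
    using Suc.IH unfolding C_def by blast
  define n where "n = Suc T"
  note pq = pq[folded n_def] and le = le[folded n_def]
  have ln: "l (Suc n) = (if s n = 2 then 1/2 else 1)"
    by (rule l)
  have sn: "s n \<in> {1, 2}" "s (Suc n) \<in> {1, 2}"
    using s(2) by (simp_all add: n_def)
  have feas: "feasible 2 (Suc n) l (x(Suc n := u))" if "feasible 2 n l x" "u \<in> {1, 2}" for x u
    using that by (intro feasible_extend) (auto simp: ln)
  have ext: "C (Suc n) l (x(Suc n := u)) = C n l x + (if u = s n then \<epsilon> else 0)
      + 2 * max 0 (real u - real (x n))" if "u \<in> {1, 2}" for x u
    unfolding C_def cost_extend ln vee_operating_cost[OF that sn(1)] by (rule refl)
  have online: "C (Suc n) l s = C n l s + (if s (Suc n) = s n then \<epsilon> else 0)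
      + 2 * max 0 (real (s (Suc n)) - real (s n))"
    using ext[OF sn(2), of s] by (simp only: fun_upd_triv)
  have "\<exists>p q. feasible 2 (Suc n) l p \<and> feasible 2 (Suc n) l q
     \<and> p (Suc n) = s (Suc n) \<and> q (Suc n) = 3 - s (Suc n)
     \<and> C (Suc n) l p + 2 * C (Suc n) l q
         \<le> (1 + 2 * \<epsilon>) * C (Suc n) l s + (if s (Suc n) = 1 then 2 + 2 * \<epsilon> else 0) + 15"
  proof (cases "s (Suc n) = s n")
    case True
    have other: "3 - s n \<in> {1, 2}" "3 - s n \<noteq> s n"
      using sn by auto
    \<comment> \<open>If all stay put, \<open>p\<close> pays \<epsilon> together with the online
      algorithm, and \<open>q\<close> sits in the uncharged state.\<close>
    have "C (Suc n) l (p(Suc n := s n)) + 2 * C (Suc n) l (q(Suc n := 3 - s n))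
        = C n l p + 2 * C n l q + \<epsilon>"
      using ext[OF sn(1), of p] ext[OF other(1), of q] other(2) pq(3,4) by simp
    moreover have "(1 + 2 * \<epsilon>) * C (Suc n) l s = (1 + 2 * \<epsilon>) * C n l s + \<epsilon> + 2 * (\<epsilon> * \<epsilon>)"
      using online True by (simp add: algebra_simps)
    moreover have "0 \<le> \<epsilon> * \<epsilon>"
      by simp
    ultimately have "C (Suc n) l (p(Suc n := s n)) + 2 * C (Suc n) l (q(Suc n := 3 - s n))
        \<le> (1 + 2 * \<epsilon>) * C (Suc n) l s + (if s (Suc n) = 1 then 2 + 2 * \<epsilon> else 0) + 15"
      using le unfolding True by linarith
    then show ?thesis
      using feas[OF pq(1) sn(1)] feas[OF pq(2) other(1)] True
      by (intro exI[of _ "p(Suc n := s n)"] exI[of _ "q(Suc n := 3 - s n)"]) simp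
  next
    case False
    then have swap: "s (Suc n) = 3 - s n" "s n = 3 - s (Suc n)"
      using sn by auto
    define p' where "p' = q(Suc n := s (Suc n))"
    obtain r where r: "r \<in> {p, q}"
      and r_le: "2 * C (Suc n) l (r(Suc n := s n))
        \<le> C (Suc n) l (p(Suc n := s n)) + C (Suc n) l (q(Suc n := s n))"
      using that[of p] that[of q]
      by (cases "C (Suc n) l (p(Suc n := s n)) \<le> C (Suc n) l (q(Suc n := s n))") simp_all
    define q' where "q' = r(Suc n := s n)"
    have "2 * C (Suc n) l q'
        \<le> C n l p + C n l q + 2 * \<epsilon> + 2 * max 0 (real (s n) - real (s (Suc n)))"
      using r_le ext[OF sn(1), of p] ext[OF sn(1), of q] pq(3,4) swap(1) by (simp add: q'_def)
    moreover have "C (Suc n) l p' = C n l q"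
      using ext[OF sn(2), of q] pq(4) swap(1) False by (simp add: p'_def)
    moreover have "(1 + 2 * \<epsilon>) * C (Suc n) l s
        = (1 + 2 * \<epsilon>) * C n l s + 2 * (1 + 2 * \<epsilon>) * max 0 (real (s (Suc n)) - real (s n))"
      using online False by (simp add: algebra_simps)
    \<comment> \<open>Both cases are tight. From 1 to 2 both sides grow by 2 \<epsilon>: the online
      term gains 2 + 4 \<epsilon> and the potential drops by 2 + 2 \<epsilon>. From 2 to 1 the
      online algorithm pays nothing, and the potential covers the 2 + 2 \<epsilon> of the offline
      side.\<close>
    moreover have "s n = 1 \<and> s (Suc n) = 2 \<or> s n = 2 \<and> s (Suc n) = 1"
      using sn False by auto
    ultimately have "C (Suc n) l p' + 2 * C (Suc n) l q'
        \<le> (1 + 2 * \<epsilon>) * C (Suc n) l s + (if s (Suc n) = 1 then 2 + 2 * \<epsilon> else 0) + 15"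
      using le eps by auto
    moreover have "feasible 2 (Suc n) l p'" "feasible 2 (Suc n) l q'"
      using feas[OF pq(2) sn(2)] feas[OF pq(1) sn(1)] feas[OF pq(2) sn(1)] r
      by (auto simp: p'_def q'_def)
    ultimately show ?thesis
      using swap(2) by (intro exI[of _ p'] exI[of _ q']) (simp add: p'_def q'_def)
  qed
  then show ?case
    by (simp add: C_def n_def)
qed

text \<open>Staying costs \<epsilon>, powering up costs 2, and powering down is free but earns the
  credit 1 of state 1. So each step gains at least \<epsilon> \<le> 1.\<close>

lemma online_cost_growth:
  assumes eps: "0 < \<epsilon>" "\<epsilon> \<le> 1"
    and s: "s 0 = 0" "\<And>t. s (Suc t) \<in> {1, 2}"
    and l: "\<And>t. l (Suc t) = (if s t = 2 then 1/2 else 1)"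
  shows "\<epsilon> * real (Suc T) \<le> cost 2 (vee \<epsilon>) (Suc T) l s + (if s (Suc T) = 1 then 1 else 0)"
proof (induction T)
  case 0
  show ?case
    using s(1) s(2)[of 0] l[of 0] eps by (auto simp: cost_Suc)
next
  case (Suc T)
  have "\<epsilon> * real (Suc (Suc T)) = \<epsilon> * real (Suc T) + \<epsilon>"
    by (simp add: algebra_simps)
  then show ?case
    using Suc.IH s(2)[of T] s(2)[of "Suc T"] l[of "Suc T"] eps
    by (auto simp: cost_Suc[of _ _ "Suc T"])
qed

theorem theorem5p2:
  "\<not> (\<exists>(A :: online_algorithm) (c :: real). c < 3 \<and> competitive A c)"
proof
  assume "\<exists>(A :: online_algorithm) (c :: real). c < 3 \<and> competitive A c"
  then obtain A :: online_algorithm and c0 :: real where c0: "c0 < 3" "competitive A c0"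
    by blast
  \<comment> \<open>Raising the ratio is harmless as the optimum is non-negative; it makes
    \<open>c\<close> positive and keeps \<epsilon> \<le> 1.\<close>
  define c where "c = max c0 1"
  define \<epsilon> where "\<epsilon> = (3 - c) / 12"
  have c: "1 \<le> c" "c < 3"
    using c0(1) by (auto simp: c_def)
  have eps: "0 < \<epsilon>" "\<epsilon> \<le> 1"
    using c by (auto simp: \<epsilon>_def)
  obtain l where l: "\<And>t. l (Suc t) =
      (if online_schedule A 2 2 (vee \<epsilon>) l t = 2 then 1/2 else 1)"
    using adaptive_loads_exist[of "\<lambda>u. if u = 2 then 1/2 else 1" A 2 2 "vee \<epsilon>"] by blast
  define s where "s = online_schedule A 2 2 (vee \<epsilon>) l"
  note l = l[folded s_def]
  have loads: "0 < l t \<and> l t \<le> 1" if "t \<ge> 1" for t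
    using that l[of "t - 1"] by (simp split: if_splits)
  have inst: "dc_instance 2 2 (vee \<epsilon>) T l" for T
    using eps loads by (force simp: dc_instance_def vee_def[of \<epsilon>] intro: convex_on_vee)
  \<comment> \<open>The algorithm does not see the horizon, so the same \<open>s\<close> and
    \<open>l\<close> serve every \<open>T\<close>.\<close>
  have feas: "feasible 2 T l s"
    and comp0: "cost 2 (vee \<epsilon>) T l s \<le> c0 * opt_cost 2 2 (vee \<epsilon>) T l" for T
    using c0(2) inst unfolding competitive_def s_def by blast+
  have comp: "cost 2 (vee \<epsilon>) T l s \<le> c * opt_cost 2 2 (vee \<epsilon>) T l" for T
  proof -
    have "c0 * opt_cost 2 2 (vee \<epsilon>) T l \<le> c * opt_cost 2 2 (vee \<epsilon>) T l"
      using opt_cost_nonneg[OF inst feas] by (intro mult_right_mono) (auto simp: c_def)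
    then show ?thesis
      using comp0[of T] by linarith
  qed
  have s0: "s 0 = 0"
    using feas[of 0] by (simp add: feasible_def)
  have s_range: "s (Suc t) \<in> {1, 2}" for t
  proof -
    have "s (Suc t) \<le> 2" "0 < real (s (Suc t))"
      using feas[of "Suc t"] loads[of "Suc t"] by (force simp: feasible_def)+
    then show ?thesis
      by auto
  qed
  define \<delta> where "\<delta> = 3 - c * (1 + 2 * \<epsilon>)"
  have delta: "0 < \<delta>"
  proof -
    \<comment> \<open>By the choice of \<epsilon>, this product is 6 \<delta>.\<close>
    have "0 < (3 - c) * (6 - c)"
      using c by simp
    then show ?thesis
      by (simp add: \<delta>_def \<epsilon>_def field_simps)
  qed
  have bound: "\<delta> * cost 2 (vee \<epsilon>) (Suc T) l s \<le> 19 * c" for T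
  proof -
    define C where "C = cost 2 (vee \<epsilon>) (Suc T) l"
    define opt where "opt = opt_cost 2 2 (vee \<epsilon>) (Suc T) l"
    obtain p q where "feasible 2 (Suc T) l p" "feasible 2 (Suc T) l q"
      and pq: "C p + 2 * C q \<le> (1 + 2 * \<epsilon>) * C s + (if s (Suc T) = 1 then 2 + 2 * \<epsilon> else 0) + 15"
      using offline_schedules[OF eps s0 s_range l] unfolding C_def by blast
    then have "opt \<le> C p" "opt \<le> C q"
      unfolding opt_def C_def by (simp_all add: opt_cost_le inst)
    \<comment> \<open>The potential is at most 4, and 15 + 4 = 19.\<close>
    with pq eps have "3 * opt \<le> (1 + 2 * \<epsilon>) * C s + 19"
      by (auto split: if_splits)
    then have "c * (3 * opt) \<le> c * ((1 + 2 * \<epsilon>) * C s + 19)"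
      using c by (intro mult_left_mono) auto
    moreover have "C s \<le> c * opt"
      unfolding C_def opt_def by (rule comp)
    ultimately show ?thesis
      by (simp add: \<delta>_def C_def[symmetric] algebra_simps)
  qed
  \<comment> \<open>The extra 1 absorbs the credit in \<open>online_cost_growth\<close>.\<close>
  obtain T where T: "(19 * c / \<delta> + 1) / \<epsilon> < real T"
    using reals_Archimedean2 by blast
  then have "19 * c / \<delta> + 1 < \<epsilon> * real T"
    using eps by (simp add: field_simps)
  also have "\<dots> \<le> \<epsilon> * real (Suc T)"
    using eps by simp
  also have "\<dots> \<le> cost 2 (vee \<epsilon>) (Suc T) l s + 1"
    using online_cost_growth[OF eps s0 s_range l, of T] by (simp split: if_splits)
  finally have "19 * c / \<delta> < cost 2 (vee \<epsilon>) (Suc T) l s"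
    by simp
  with bound[of T] delta show False
    by (simp add: field_simps)
qed

end
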